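(* Let $G$ be a compact group acting measurably on a sample space $\mathcal X$, and let $\pi:\mathcal X\to\mathcal X/G$ be the quotient map sending each point to its orbit. Let $\{P_\theta:\theta\in\Theta\}$ be a dominated statistical family on $\mathcal X$ with densities $p_\theta(x)$ with respect to the dominating measure. Suppose that the likelihood is invariant along group orbits: $$p_\theta(gx)=p_\theta(x)\quad\text{for all } g\in G,\ x\in\mathcal X,\ \theta\in\Theta.$$ Then, for $X\sim P_\theta$, the statistic $\pi(X)$ is sufficient for $\theta$.
   Context: The sample space $\mathcal X$ is a measurable space. $\mathcal X/G$ is the set of orbits $[x]=Gx=\{gx:g\in G\}$, with $\pi(x)=[x]$, equipped with the quotient $\sigma$-algebra (a set $B\subseteq\mathcal X/G$ is measurable iff $\pi^{-1}(B)$ is measurable in $\mathcal X$). "Dominated" means that there is a $\sigma$-finite measure $\mu$ on $\mathcal X$ such that every $P_\theta$ is absolutely continuous with respect to $\mu$; $p_\theta=dP_\theta/d\mu$ denotes a fixed version of the density. A statistic $T(X)$ is sufficient for $\theta$ if the conditional distribution of $X$ given $T(X)$ does not depend on $\theta$ (for each measurable $A$ there is a version of $P_\theta(X\in A\mid T(X))$ common to all $\theta\in\Theta$). *)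

theory Defs
  imports "HOL-Probability.Probability" "HOL-Algebra.Group_Action"
begin

definition borel_of :: "'a topology \<Rightarrow> 'a measure" where
  "borel_of T = sigma (topspace T) {U. openin T U}"

locale topological_group = group G for G (structure) +
  fixes T :: "'a topology"
  assumes topspace_eq: "topspace T = carrier G"
    and continuous_mult: "continuous_map (prod_topology T T) T (\<lambda>(g, h). g \<otimes> h)"
    and continuous_inv: "continuous_map T T (\<lambda>g. inv g)"

(* The Hausdorff axiom is not part of this definition. *)
locale compact_group = topological_group +
  assumes compact: "compact_space T"

text \<open>Only the space and the sets of \<open>X\<close> matter: it stands for a measurable space, and the
  measure it carries is irrelevant. The same holds for the argument \<open>N\<close> of \<open>sufficient\<close>.\<close>

locale measurable_action = group_action G "space X" \<phi>
  for G :: "('g, 'm) monoid_scheme" and T :: "'g topology" and X :: "'x measure"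
    and \<phi> :: "'g \<Rightarrow> 'x \<Rightarrow> 'x" +
  assumes measurable_act: "(\<lambda>(g, x). \<phi> g x) \<in> borel_of T \<Otimes>\<^sub>M X \<rightarrow>\<^sub>M X"

text \<open>The set of orbits with the quotient sigma-algebra; the quotient map is \<open>orbit G \<phi>\<close>.\<close>

definition orbit_space ::
    "('g, 'm) monoid_scheme \<Rightarrow> 'x measure \<Rightarrow> ('g \<Rightarrow> 'x \<Rightarrow> 'x) \<Rightarrow> 'x set measure" where
  "orbit_space G X \<phi> = sigma (orbits G (space X) \<phi>)
     {B. B \<subseteq> orbits G (space X) \<phi> \<and> orbit G \<phi> -` B \<inter> space X \<in> sets X}"

lemma space_orbit_space: "space (orbit_space G X \<phi>) = orbits G (space X) \<phi>"
  unfolding orbit_space_def by (rule space_measure_of) auto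

lemma sets_orbit_space:
  "B \<in> sets (orbit_space G X \<phi>) \<longleftrightarrow>
     B \<subseteq> orbits G (space X) \<phi> \<and> orbit G \<phi> -` B \<inter> space X \<in> sets X"
proof -
  let ?O = "orbits G (space X) \<phi>"
  let ?S = "{B. B \<subseteq> ?O \<and> orbit G \<phi> -` B \<inter> space X \<in> sets X}"
  have "sigma_algebra ?O ?S"
  proof (rule sigma_algebra_iff2[THEN iffD2], intro conjI ballI allI impI)
    fix B assume "B \<in> ?S"
    moreover have "orbit G \<phi> -` (?O - B) \<inter> space X = space X - (orbit G \<phi> -` B \<inter> space X)"
      by (auto simp: orbits_def)
    ultimately show "?O - B \<in> ?S" by auto
  next
    fix A :: "nat \<Rightarrow> _" assume A: "range A \<subseteq> ?S"
    have "orbit G \<phi> -` (\<Union>i. A i) \<inter> space X = (\<Union>i. orbit G \<phi> -` A i \<inter> space X)" by auto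
    also have "\<dots> \<in> sets X" using A by (intro sets.countable_UN) auto
    finally show "(\<Union>i. A i) \<in> ?S" using A by auto
  qed auto
  then show ?thesis
    unfolding orbit_space_def
    by (subst sigma_algebra.sets_measure_of_eq) auto
qed

text \<open>The family \<open>P \<theta>\<close>, \<open>\<theta> \<in> \<Theta>\<close>, consists of probability measures on \<open>X\<close>, so that the statistic
  is \<open>S\<close> itself, viewed as a random variable on the sample space. The sigma-algebra generated by
  the statistic is \<open>vimage_algebra (space X) S N\<close>, and \<open>h\<close> is the version of the conditional
  probability of \<open>A\<close> given \<open>S\<close> that is common to the whole family.\<close>

definition sufficient ::
    "'x measure \<Rightarrow> 't set \<Rightarrow> ('t \<Rightarrow> 'x measure) \<Rightarrow> 'y measure \<Rightarrow> ('x \<Rightarrow> 'y) \<Rightarrow> bool" where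
  "sufficient X \<Theta> P N S \<longleftrightarrow>
     S \<in> X \<rightarrow>\<^sub>M N \<and>
     (\<forall>A\<in>sets X. \<exists>h \<in> borel_measurable (vimage_algebra (space X) S N).
        \<forall>\<theta>\<in>\<Theta>. AE x in P \<theta>.
          h x = real_cond_exp (P \<theta>) (vimage_algebra (space X) S N) (indicator A) x)"

end

theory Submission
  imports Defs
begin

text \<open>
  The theorem is an instance of the factorization criterion for sufficiency. The sets of the
  \<open>\<sigma>\<close>-algebra generated by \<open>\<pi>\<close> are exactly the measurable unions of orbits
  (this is what the quotient \<open>\<sigma>\<close>-algebra is made for), so a measurable function that is
  constant on orbits, such as each likelihood \<open>p\<^sub>\<theta>\<close>, is measurable with respect to it:
  \<open>measurable_orbit_sigma_algebra\<close>. It remains to see that a family dominated by \<open>\<mu>\<close> whose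
  densities are measurable with respect to \<open>\<sigma>(S)\<close> has \<open>S\<close> as a sufficient statistic:
  \<open>sufficient_if_densities_measurable\<close>.

  If \<open>\<mu>\<close> were finite, \<open>P\<^sub>\<theta>(A | S) = \<mu>(A | S)\<close> would settle this. In general \<open>\<mu>\<close> need not even be
  \<open>\<sigma>\<close>-finite on \<open>\<sigma>(S)\<close> (where all densities vanish, an infinite mass may be spread over a
  single orbit), so that conditional expectations with respect to \<open>\<mu>\<close> need not exist. Instead,
  write \<open>\<mu> = k \<nu>\<close> with a finite measure \<open>\<nu>\<close>; the densities become \<open>p\<^sub>\<theta> k\<close>, where \<open>k\<close> is in general not \<open>\<sigma>(S)\<close>-measurable but
  does not depend on \<open>\<theta>\<close>. Bayes' formula (\<open>nn_cond_exp_density\<close>) then gives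
  \<open>P\<^sub>\<theta>(A | S) = E\<^sub>\<nu>(k 1\<^sub>A | S) / E\<^sub>\<nu>(k | S)\<close>,
  in which the factor \<open>p\<^sub>\<theta>\<close> has cancelled.
\<close>

section \<open>Conditional expectation under a change of measure\<close>

text \<open>
  Bayes' formula. Under the new measure, the integral over \<open>B \<in> F\<close> of an \<open>F\<close>-measurable \<open>q\<close> is
  \<open>\<integral>\<^sub>B g q E(k | F)\<close> and that of \<open>f\<close> is \<open>\<integral>\<^sub>B g E(k f | F)\<close>; they agree for the quotient \<open>q\<close>
  wherever the denominator cancels.
  Where \<open>E(k | F)\<close> vanishes, so does \<open>k\<close>, and with it the numerator. Where \<open>E(k | F)\<close> is
  infinite, \<open>g\<close> must vanish, because \<open>g E(k | F)\<close> has the finite integral \<open>\<integral> g k\<close>; hence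
  this set is null for the new measure.
\<close>

lemma (in sigma_finite_subalgebra) nn_cond_exp_density:
  fixes f g k :: "'a \<Rightarrow> ennreal"
  assumes f[measurable]: "f \<in> borel_measurable M"
    and k[measurable]: "k \<in> borel_measurable M"
    and g[measurable]: "g \<in> borel_measurable F"
    and fin: "finite_measure (density M (\<lambda>x. g x * k x))"
  shows "AE x in density M (\<lambda>x. g x * k x).
    nn_cond_exp M F (\<lambda>x. k x * f x) x / nn_cond_exp M F k x =
    nn_cond_exp (density M (\<lambda>x. g x * k x)) F f x"
proof -
  define P where "P = density M (\<lambda>x. g x * k x)"
  define a where "a = nn_cond_exp M F (\<lambda>x. k x * f x)"
  define b where "b = nn_cond_exp M F k"
  have aF[measurable]: "a \<in> borel_measurable F" and bF[measurable]: "b \<in> borel_measurable F"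
    by (simp_all add: a_def b_def)
  have gM[measurable]: "g \<in> borel_measurable M"
    and aM[measurable]: "a \<in> borel_measurable M" and bM[measurable]: "b \<in> borel_measurable M"
    using measurable_from_subalg[OF subalg] g aF bF by blast+
  have subP: "subalgebra P F"
    using subalg by (simp add: subalgebra_def P_def)
  interpret P: finite_measure_subalgebra P F
    using fin subP by (simp add: finite_measure_subalgebra_def finite_measure_subalgebra_axioms_def P_def)

  have a_int: "(\<integral>\<^sup>+x. u x * a x \<partial>M) = (\<integral>\<^sup>+x. u x * (k x * f x) \<partial>M)"
    if "u \<in> borel_measurable F" for u
    unfolding a_def using that by (intro nn_cond_exp_intg) auto
  have b_int: "(\<integral>\<^sup>+x. u x * b x \<partial>M) = (\<integral>\<^sup>+x. u x * k x \<partial>M)"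
    if "u \<in> borel_measurable F" for u
    unfolding b_def using that by (intro nn_cond_exp_intg) auto

  have a0: "AE x in M. b x = 0 \<longrightarrow> a x = 0"
  proof -
    define Z where "Z = {x \<in> space F. b x = 0}"
    have ZF[measurable]: "Z \<in> sets F" by (simp add: Z_def)
    have ZM[measurable]: "Z \<in> sets M" using ZF subalg by (auto simp: subalgebra_def)
    have iZ: "(indicator Z :: 'a \<Rightarrow> ennreal) \<in> borel_measurable F" by measurable
    have "(\<integral>\<^sup>+x. indicator Z x * k x \<partial>M) = (\<integral>\<^sup>+x. indicator Z x * b x \<partial>M)"
      by (rule b_int[OF iZ, symmetric])
    also have "\<dots> = 0"
      by (rule nn_integral_zero') (auto simp: Z_def indicator_def)
    finally have "AE x in M. indicator Z x * k x = 0"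
      by (subst (asm) nn_integral_0_iff_AE) auto
    then have "(\<integral>\<^sup>+x. indicator Z x * (k x * f x) \<partial>M) = 0"
      by (intro nn_integral_zero') auto
    then have "(\<integral>\<^sup>+x. indicator Z x * a x \<partial>M) = 0"
      by (simp add: a_int[OF iZ])
    then have "AE x in M. indicator Z x * a x = 0"
      by (subst (asm) nn_integral_0_iff_AE) auto
    moreover have "space F = space M" using subalg by (simp add: subalgebra_def)
    ultimately show ?thesis
      by (auto simp: Z_def indicator_def split: if_splits elim!: AE_mp)
  qed

  have b_fin: "AE x in M. g x * b x \<noteq> \<infinity>"
  proof (rule nn_integral_noteq_infinite)
    have "(\<integral>\<^sup>+x. g x * b x \<partial>M) = (\<integral>\<^sup>+x. g x * k x \<partial>M)"
      by (rule b_int) measurable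
    also have "\<dots> = emeasure P (space P)"
      unfolding P_def by (subst emeasure_density) (auto intro!: nn_integral_cong)
    finally show "(\<integral>\<^sup>+x. g x * b x \<partial>M) \<noteq> \<infinity>"
      using P.emeasure_finite by simp
  qed measurable

  have cancel: "AE x in M. g x * (a x / b x) * b x = g x * a x"
    using a0 b_fin
  proof eventually_elim
    case (elim x)
    show ?case
    proof (cases "g x = 0 \<or> b x = 0")
      case True
      then show ?thesis using elim by auto
    next
      case False
      then have "b x \<noteq> \<infinity>" using elim by (auto simp: ennreal_mult_eq_top_iff)
      then have "a x / b x * b x = a x"
        using False by (simp add: ennreal_divide_times ennreal_divide_self less_top)
      then show ?thesis by (simp add: mult.assoc)
    qed
  qed

  have "AE x in P. a x / b x = nn_cond_exp P F f x"
  proof (rule P.nn_cond_exp_charact)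
    fix B assume B[measurable]: "B \<in> sets F"
    have BM[measurable]: "B \<in> sets M" using B subalg by (auto simp: subalgebra_def)
    have "(\<integral>\<^sup>+x\<in>B. (a x / b x) \<partial>P) = (\<integral>\<^sup>+x. (indicator B x * g x * (a x / b x)) * k x \<partial>M)"
      unfolding P_def by (subst nn_integral_density) (auto simp: ac_simps)
    also have "\<dots> = (\<integral>\<^sup>+x. (indicator B x * g x * (a x / b x)) * b x \<partial>M)"
      by (rule b_int[symmetric]) measurable
    also have "\<dots> = (\<integral>\<^sup>+x. (indicator B x * g x) * a x \<partial>M)"
      using cancel by (intro nn_integral_cong_AE) (auto simp: mult.assoc elim!: AE_mp)
    also have "\<dots> = (\<integral>\<^sup>+x. (indicator B x * g x) * (k x * f x) \<partial>M)"
      by (rule a_int) measurable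
    also have "\<dots> = (\<integral>\<^sup>+x\<in>B. f x \<partial>P)"
      unfolding P_def by (subst nn_integral_density) (auto simp: ac_simps)
    finally show "(\<integral>\<^sup>+x\<in>B. f x \<partial>P) = (\<integral>\<^sup>+x\<in>B. (a x / b x) \<partial>P)" by simp
  qed (auto simp: P_def)
  then show ?thesis unfolding P_def a_def b_def .
qed

lemma (in sigma_finite_subalgebra) real_cond_exp_nonneg_eq:
  assumes [measurable]: "f \<in> borel_measurable M" and nonneg: "\<And>x. 0 \<le> f x"
  shows "AE x in M. real_cond_exp M F f x = enn2real (nn_cond_exp M F (\<lambda>x. ennreal (f x)) x)"
proof -
  have "(\<lambda>x. ennreal (- f x)) = (\<lambda>x. 0)"
    using nonneg by (auto simp: ennreal_neg)
  moreover have "AE x in M. 0 = nn_cond_exp M F (\<lambda>x. 0) x"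
    by (intro nn_cond_exp_F_meas) auto
  ultimately show ?thesis
    by (auto simp: real_cond_exp_def elim!: AE_mp)
qed

text \<open>
  The finite measure \<open>\<nu> = w M\<close> comes from a positive integrable weight \<open>w\<close>, and \<open>k = 1 / w\<close>.
  Finiteness is what makes \<open>\<nu>\<close> \<open>\<sigma>\<close>-finite on every sub-\<open>\<sigma>\<close>-algebra, so that conditional
  expectations with respect to it exist.
\<close>

lemma (in sigma_finite_measure) eq_density_finite_measure:
  obtains \<nu> k where "finite_measure \<nu>" "sets \<nu> = sets M" "k \<in> borel_measurable M"
    "M = density \<nu> k"
proof -
  obtain w where w[measurable]: "w \<in> borel_measurable M" and fin: "integral\<^sup>N M w \<noteq> \<infinity>"
    and pos: "\<And>x. x \<in> space M \<Longrightarrow> 0 < w x \<and> w x < \<infinity>"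
    using Ex_finite_integrable_function by blast
  have "finite_measure (density M w)"
    using fin by (intro finite_measureI) (simp cong: nn_integral_cong add: emeasure_density)
  moreover have "M = density (density M w) (\<lambda>x. 1 / w x)"
  proof -
    have "density (density M w) (\<lambda>x. 1 / w x) = density M (\<lambda>x. w x * (1 / w x))"
      by (rule density_density_eq) measurable
    also have "\<dots> = density M (\<lambda>x. 1)"
    proof (rule density_cong)
      show "AE x in M. w x * (1 / w x) = 1"
      proof (rule AE_I2)
        fix x assume "x \<in> space M"
        then show "w x * (1 / w x) = 1"
          using pos[of x] ennreal_divide_self[of "w x"] by (auto simp: ennreal_times_divide)
      qed
    qed measurable
    also have "\<dots> = M" by (rule density_1)
    finally show ?thesis ..
  qed
  ultimately show thesis
    by (intro that[of "density M w" "\<lambda>x. 1 / w x"]) auto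
qed

section \<open>The factorization criterion\<close>

text \<open>
  The quotient in Bayes' formula involves \<open>\<nu>\<close>, \<open>k\<close> and \<open>A\<close> but not the density \<open>p \<theta>\<close>: it is one
  version of the conditional probability of \<open>A\<close> for all \<open>\<theta>\<close>.
\<close>

theorem sufficient_if_densities_measurable:
  fixes X \<mu> :: "'x measure" and N :: "'y measure" and S :: "'x \<Rightarrow> 'y"
    and p :: "'t \<Rightarrow> 'x \<Rightarrow> ennreal"
  assumes S: "S \<in> X \<rightarrow>\<^sub>M N"
    and \<mu>: "sigma_finite_measure \<mu>" "sets \<mu> = sets X"
    and P: "\<And>\<theta>. \<theta> \<in> \<Theta> \<Longrightarrow> finite_measure (P \<theta>)" "\<And>\<theta>. \<theta> \<in> \<Theta> \<Longrightarrow> P \<theta> = density \<mu> (p \<theta>)"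
    and p: "\<And>\<theta>. \<theta> \<in> \<Theta> \<Longrightarrow> p \<theta> \<in> borel_measurable (vimage_algebra (space X) S N)"
  shows "sufficient X \<Theta> P N S"
proof -
  define F where "F = vimage_algebra (space X) S N"
  obtain \<nu> k where \<nu>: "finite_measure \<nu>" and sets_\<nu>: "sets \<nu> = sets \<mu>"
    and k: "k \<in> borel_measurable \<mu>" and \<mu>_eq: "\<mu> = density \<nu> k"
    using sigma_finite_measure.eq_density_finite_measure[OF \<mu>(1)] by blast
  have k[measurable]: "k \<in> borel_measurable \<nu>"
    using k sets_\<nu> by (simp cong: measurable_cong_sets)
  have space_\<nu>: "space \<nu> = space X"
    using sets_\<nu> \<mu>(2) by (metis sets_eq_imp_space_eq)
  have F: "subalgebra \<nu> F"
    using S sets_\<nu> \<mu>(2) space_\<nu>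
    by (auto simp: subalgebra_def F_def sets_vimage_algebra2 measurable_space measurable_sets)
  interpret \<nu>: finite_measure_subalgebra \<nu> F
    using \<nu> F by (simp add: finite_measure_subalgebra_def finite_measure_subalgebra_axioms_def)

  have "\<exists>h \<in> borel_measurable F. \<forall>\<theta>\<in>\<Theta>. AE x in P \<theta>. h x = real_cond_exp (P \<theta>) F (indicator A) x"
    if A: "A \<in> sets X" for A
  proof (intro bexI ballI)
    define h where
      "h = (\<lambda>x. nn_cond_exp \<nu> F (\<lambda>x. k x * indicator A x) x / nn_cond_exp \<nu> F k x)"
    show "(\<lambda>x. enn2real (h x)) \<in> borel_measurable F"
      unfolding h_def by measurable
    fix \<theta> assume \<theta>: "\<theta> \<in> \<Theta>"
    have A\<nu>[measurable]: "A \<in> sets \<nu>" using A sets_\<nu> \<mu>(2) by simp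
    have pF[measurable]: "p \<theta> \<in> borel_measurable F" using p[OF \<theta>] by (simp add: F_def)
    have p\<nu>[measurable]: "p \<theta> \<in> borel_measurable \<nu>" by (rule measurable_from_subalg[OF F pF])
    have P_eq: "P \<theta> = density \<nu> (\<lambda>x. p \<theta> x * k x)"
      by (simp add: P(2)[OF \<theta>] \<mu>_eq density_density_eq mult.commute)
    interpret P: finite_measure_subalgebra "P \<theta>" F
      using P(1)[OF \<theta>] F
      by (simp add: finite_measure_subalgebra_def finite_measure_subalgebra_axioms_def
          subalgebra_def P_eq)
    have "AE x in P \<theta>. h x = nn_cond_exp (P \<theta>) F (indicator A) x"
      using \<nu>.nn_cond_exp_density[of "indicator A" k "p \<theta>"] P(1)[OF \<theta>]
      unfolding h_def P_eq by simp
    moreover have "AE x in P \<theta>. real_cond_exp (P \<theta>) F (indicator A) x =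
        enn2real (nn_cond_exp (P \<theta>) F (indicator A) x)"
    proof -
      have "indicator A \<in> borel_measurable (P \<theta>)" by (simp add: P_eq)
      from P.real_cond_exp_nonneg_eq[OF this] show ?thesis by (simp add: ennreal_indicator)
    qed
    ultimately show "AE x in P \<theta>. enn2real (h x) = real_cond_exp (P \<theta>) F (indicator A) x"
      by (auto elim!: AE_mp)
  qed
  then show ?thesis
    using S by (simp add: sufficient_def F_def)
qed

section \<open>The orbit map\<close>

lemma (in group_action) orbit_eq_iff:
  assumes "x \<in> E" "y \<in> E"
  shows "orbit G \<phi> x = orbit G \<phi> y \<longleftrightarrow> (\<exists>g\<in>carrier G. y = \<phi> g x)"
proof
  assume "orbit G \<phi> x = orbit G \<phi> y"
  then have "y \<in> orbit G \<phi> x" using orbit_refl[OF assms(2)] by simp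
  then show "\<exists>g\<in>carrier G. y = \<phi> g x" by (auto simp: orbit_def)
next
  assume "\<exists>g\<in>carrier G. y = \<phi> g x"
  then have "y \<in> orbit G \<phi> x" by (auto simp: orbit_def)
  moreover have "y \<in> orbit G \<phi> y" by (rule orbit_refl[OF assms(2)])
  moreover have "orbit G \<phi> x \<in> orbits G E \<phi>" "orbit G \<phi> y \<in> orbits G E \<phi>"
    using assms by (auto simp: orbits_def)
  ultimately show "orbit G \<phi> x = orbit G \<phi> y"
    using disjoint_union by blast
qed

lemma measurable_orbit: "orbit G \<phi> \<in> X \<rightarrow>\<^sub>M orbit_space G X \<phi>"
  by (rule measurableI) (auto simp: space_orbit_space sets_orbit_space orbits_def)

text \<open>
  The preimage of a measurable set under an invariant function is a measurable union of orbits,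
  hence the \<open>\<pi>\<close>-preimage of its own image under \<open>\<pi>\<close>; that image is measurable by the very
  definition of the quotient \<open>\<sigma>\<close>-algebra.
\<close>

lemma measurable_orbit_sigma_algebra:
  assumes "group_action G (space X) \<phi>"
    and f: "f \<in> X \<rightarrow>\<^sub>M Y"
    and inv: "\<And>g x. g \<in> carrier G \<Longrightarrow> x \<in> space X \<Longrightarrow> f (\<phi> g x) = f x"
  shows "f \<in> vimage_algebra (space X) (orbit G \<phi>) (orbit_space G X \<phi>) \<rightarrow>\<^sub>M Y"
proof (rule measurableI)
  interpret group_action G "space X" \<phi> by fact
  fix B assume B: "B \<in> sets Y"
  define C where "C = f -` B \<inter> space X"
  have C: "C \<in> sets X" unfolding C_def by (rule measurable_sets[OF f B])
  have saturated: "orbit G \<phi> -` (orbit G \<phi> ` C) \<inter> space X = C"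
  proof (intro equalityI subsetI)
    fix x assume x: "x \<in> orbit G \<phi> -` (orbit G \<phi> ` C) \<inter> space X"
    then obtain y where y: "y \<in> C" "orbit G \<phi> y = orbit G \<phi> x" by auto
    then obtain g where "g \<in> carrier G" "x = \<phi> g y"
      using orbit_eq_iff[of y x] x by (auto simp: C_def)
    then show "x \<in> C" using x y inv[of g y] by (auto simp: C_def)
  qed (auto simp: C_def)
  then have "orbit G \<phi> ` C \<in> sets (orbit_space G X \<phi>)"
    using C by (auto simp: sets_orbit_space orbits_def C_def)
  from in_vimage_algebra[OF this, of "orbit G \<phi>" "space X"]
  show "f -` B \<inter> space (vimage_algebra (space X) (orbit G \<phi>) (orbit_space G X \<phi>))
      \<in> sets (vimage_algebra (space X) (orbit G \<phi>) (orbit_space G X \<phi>))"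
    by (simp add: saturated) (simp add: C_def)
qed (use measurable_space[OF f] in simp)

section \<open>Sufficiency of the orbit\<close>

theorem theorem1:
  fixes G :: "('g, 'm) monoid_scheme" and T :: "'g topology"
    and X :: "'x measure" and \<phi> :: "'g \<Rightarrow> 'x \<Rightarrow> 'x"
    and \<Theta> :: "'t set" and P :: "'t \<Rightarrow> 'x measure"
    and \<mu> :: "'x measure" and p :: "'t \<Rightarrow> 'x \<Rightarrow> ennreal"
  assumes "compact_group G T"
    and "measurable_action G T X \<phi>"
    and "\<And>\<theta>. \<theta> \<in> \<Theta> \<Longrightarrow> prob_space (P \<theta>)"
    and "\<And>\<theta>. \<theta> \<in> \<Theta> \<Longrightarrow> sets (P \<theta>) = sets X"
    and "sigma_finite_measure \<mu>" and "sets \<mu> = sets X"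
    and "\<And>\<theta>. \<theta> \<in> \<Theta> \<Longrightarrow> absolutely_continuous \<mu> (P \<theta>)"
    and "\<And>\<theta>. \<theta> \<in> \<Theta> \<Longrightarrow> p \<theta> \<in> borel_measurable \<mu>"
    and "\<And>\<theta>. \<theta> \<in> \<Theta> \<Longrightarrow> P \<theta> = density \<mu> (p \<theta>)"
    and "\<And>g x \<theta>. g \<in> carrier G \<Longrightarrow> x \<in> space X \<Longrightarrow> \<theta> \<in> \<Theta> \<Longrightarrow> p \<theta> (\<phi> g x) = p \<theta> x"
  shows "sufficient X \<Theta> P (orbit_space G X \<phi>) (orbit G \<phi>)"
proof (rule sufficient_if_densities_measurable)
  interpret measurable_action G T X \<phi> by fact
  fix \<theta> assume \<theta>: "\<theta> \<in> \<Theta>"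
  show "finite_measure (P \<theta>)" using assms(3)[OF \<theta>] by (simp add: prob_space_def)
  show "P \<theta> = density \<mu> (p \<theta>)" using assms(9)[OF \<theta>] .
  show "p \<theta> \<in> borel_measurable (vimage_algebra (space X) (orbit G \<phi>) (orbit_space G X \<phi>))"
  proof (rule measurable_orbit_sigma_algebra[OF group_action_axioms])
    show "p \<theta> \<in> borel_measurable X"
      using assms(8)[OF \<theta>] assms(6) by (simp cong: measurable_cong_sets)
  qed (use assms(10) \<theta> in auto)
qed (use assms(5,6) measurable_orbit in auto)

end
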